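(* The mixed finite difference discretization $\mathcal F_h(\mathbf x_{i,j},u_h)=\mathcal F_h(\mathbf x_{i,j},u_{i,j},\{u_{p,q}\}_{(p,q)\ne(i,j)})=0$ defined in the context is monotone. More specifically, for all $u_h\le v_h$ (entrywise) and every interior grid point $\mathbf x_{i,j}$, $$\mathcal F_h(\mathbf x_{i,j},u_{i,j},\{u_{p,q}\}_{(p,q)\ne(i,j)})\le\mathcal F_h(\mathbf x_{i,j},v_{i,j},\{u_{p,q}\}_{(p,q)\ne(i,j)}),$$ $$\mathcal F_h(\mathbf x_{i,j},u_{i,j},\{u_{p,q}\}_{(p,q)\ne(i,j)})\ge\mathcal F_h(\mathbf x_{i,j},u_{i,j},\{v_{p,q}\}_{(p,q)\ne(i,j)}).$$
   Context: **Setting.** $\Omega\subset\mathbb R^2$ is a bounded convex open set, $f:\Omega\to\mathbb R$ with $f\ge0$, $g:\partial\Omega\to\mathbb R$. $\Gamma=[0,1]\times[-\frac\pi4,\frac\pi4)$ and, for $(a,\theta)\in\Gamma$, $\alpha_{11}=\frac12[1-(1-2a)\cos2\theta]$, $\alpha_{22}=\frac12[1+(1-2a)\cos2\theta]$, $\alpha_{12}=\frac12(1-2a)\sin2\theta$. **Grid.** An $N\times N$ square grid of mesh size $h$ with points $\mathbf x_{i,j}=(x_i,y_j)$, $0\le i,j\le N+1$; $\mathbf x_{i,j}\in\Omega$ for $1\le i,j\le N$, and $\mathbf x_{i,j}\in\partial\Omega$ if $i$ or $j$ is in $\{0,N+1\}$ (so $\Omega$ is an open axis-parallel square). Grid vectors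 are $u_h=(u_{1,1},u_{1,2},\dots,u_{N,N})^T\in\mathbb R^{N^2}$; at boundary grid points $u_{i,j}=g(\mathbf x_{i,j})$. **Scheme at an interior grid point $\mathbf x_{i,j}$ with control $(a,\theta)\in\Gamma$.** (i) If $\alpha_{11}\ge|\alpha_{12}|$ and $\alpha_{22}\ge|\alpha_{12}|$ (standard 7-point stencil), set $\mathcal L_{i,j}(a,\theta;u_h)=-\alpha_{11}\delta_{xx}u-2\alpha_{12}\delta_{xy}u-\alpha_{22}\delta_{yy}u+2\sqrt{a(1-a)f(\mathbf x_{i,j})}$, where $\delta_{xx}u=(u_{i+1,j}-2u_{i,j}+u_{i-1,j})/h^2$, $\delta_{yy}u=(u_{i,j+1}-2u_{i,j}+u_{i,j-1})/h^2$, and $\delta_{xy}u=\frac{1}{2h^2}(2u_{i,j}+u_{i+1,j+1}+u_{i-1,j-1}-u_{i+1,j}-u_{i-1,j}-u_{i,j+1}-u_{i,j-1})$ if $\alpha_{12}\ge0$, $\delta_{xy}u=\frac{1}{2h^2}(-2u_{i,j}-u_{i+1,j-1}-u_{i-1,j+1}+u_{i+1,j}+u_{i-1,j}+u_{i,j+1}+u_{i,j-1})$ if $\alpha_{12}\le0$. (ii) Otherwise (semi-Lagrangian wide stencil), let $\mathbf e_z=(\cos\theta,-\sin\theta)$, $\mathbf e_w=(\sin\theta,\cos\theta)$ and set $\mathcal L_{i,j}(a,\theta;u_h)=-a\,\delta_{zz}u-(1-a)\,\delta_{ww}u+2\sqrt{a(1-a)f(\mathbf x_{i,j})}$, where for $\mathbf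 e=\mathbf e_z$ (respectively $\mathbf e_w$) $\delta_{\mathbf e\mathbf e}u=\frac{2}{\eta_++\eta_-}\Big(\frac{v_+-u_{i,j}}{\eta_+}-\frac{u_{i,j}-v_-}{\eta_-}\Big)$. If $\mathbf x_{i,j}\pm\sqrt h\,\mathbf e\in\overline\Omega$, then $\eta_\pm=\sqrt h$ and $v_\pm=\mathcal I_hu$ evaluated at $\mathbf x_{i,j}\pm\sqrt h\,\mathbf e$, with $\mathcal I_h$ the bilinear interpolation from the four surrounding grid points. Otherwise $\eta_\pm\in(0,\sqrt h)$ is such that $\mathbf x_{i,j}\pm\eta_\pm\mathbf e\in\partial\Omega$, and $v_\pm=g(\mathbf x_{i,j}\pm\eta_\pm\mathbf e)$. Then $\mathcal F_h(\mathbf x_{i,j},u_h)=\max_{(a,\theta)\in\Gamma}\mathcal L_{i,j}(a,\theta;u_h)$, the maximum being understood as a supremum. *)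

theory Defs
  imports "HOL-Analysis.Analysis"
begin

definition control_set :: "(real \<times> real) set" where
  "control_set = {0..1} \<times> {- pi / 4 ..< pi / 4}"

definition alpha11 :: "real \<Rightarrow> real \<Rightarrow> real" where
  "alpha11 a \<theta> = (1 - (1 - 2 * a) * cos (2 * \<theta>)) / 2"

definition alpha22 :: "real \<Rightarrow> real \<Rightarrow> real" where
  "alpha22 a \<theta> = (1 + (1 - 2 * a) * cos (2 * \<theta>)) / 2"

definition alpha12 :: "real \<Rightarrow> real \<Rightarrow> real" where
  "alpha12 a \<theta> = (1 - 2 * a) * sin (2 * \<theta>) / 2"

text \<open>The grid has lower left corner \<open>z\<close> and mesh size \<open>h\<close>.\<close>

definition grid_point :: "real \<times> real \<Rightarrow> real \<Rightarrow> nat \<Rightarrow> nat \<Rightarrow> real \<times> real" where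
  "grid_point z h i j = (fst z + real i * h, snd z + real j * h)"

text \<open>A grid vector is a function on index pairs of which only the entries with indices in
  \<open>{1..N}\<close> are ever used; at the boundary grid points the value is prescribed by \<open>g\<close>.\<close>

definition grid_value ::
  "(real \<times> real \<Rightarrow> real) \<Rightarrow> real \<times> real \<Rightarrow> real \<Rightarrow> nat \<Rightarrow> (nat \<times> nat \<Rightarrow> real) \<Rightarrow> nat \<Rightarrow> nat \<Rightarrow> real" where
  "grid_value g z h N u p q =
     (if p \<in> {1..N} \<and> q \<in> {1..N} then u (p, q) else g (grid_point z h p q))"

text \<open>The difference quotients below act on a lattice function \<open>U\<close> (a grid vector together with
  its boundary values) and are used only for \<open>i, j \<ge> 1\<close>, so that \<open>i - 1\<close> and \<open>j - 1\<close> do not truncate.\<close>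

definition delta_xx :: "real \<Rightarrow> (nat \<Rightarrow> nat \<Rightarrow> real) \<Rightarrow> nat \<Rightarrow> nat \<Rightarrow> real" where
  "delta_xx h U i j = (U (i + 1) j - 2 * U i j + U (i - 1) j) / h\<^sup>2"

definition delta_yy :: "real \<Rightarrow> (nat \<Rightarrow> nat \<Rightarrow> real) \<Rightarrow> nat \<Rightarrow> nat \<Rightarrow> real" where
  "delta_yy h U i j = (U i (j + 1) - 2 * U i j + U i (j - 1)) / h\<^sup>2"

text \<open>The argument \<open>c\<close> is the coefficient \<open>alpha12\<close> whose sign selects the stencil. For \<open>c = 0\<close>
  the choice is immaterial, since the quotient is then multiplied by \<open>c\<close>.\<close>

definition delta_xy :: "real \<Rightarrow> real \<Rightarrow> (nat \<Rightarrow> nat \<Rightarrow> real) \<Rightarrow> nat \<Rightarrow> nat \<Rightarrow> real" where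
  "delta_xy c h U i j =
     (if c \<ge> 0
      then 1 / (2 * h\<^sup>2) * (2 * U i j + U (i + 1) (j + 1) + U (i - 1) (j - 1)
             - U (i + 1) j - U (i - 1) j - U i (j + 1) - U i (j - 1))
      else 1 / (2 * h\<^sup>2) * (- 2 * U i j - U (i + 1) (j - 1) - U (i - 1) (j + 1)
             + U (i + 1) j + U (i - 1) j + U i (j + 1) + U i (j - 1)))"

text \<open>Bilinear interpolation. The cell containing \<open>y\<close> has lower left index \<open>(p, q)\<close>; the minimum
  with \<open>N\<close> keeps the cell inside the grid when \<open>y\<close> lies on the right or upper edge.\<close>

definition bilinear_interp ::
  "real \<times> real \<Rightarrow> real \<Rightarrow> nat \<Rightarrow> (nat \<Rightarrow> nat \<Rightarrow> real) \<Rightarrow> real \<times> real \<Rightarrow> real" where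
  "bilinear_interp z h N U y =
     (let p = min N (nat \<lfloor>(fst y - fst z) / h\<rfloor>);
          q = min N (nat \<lfloor>(snd y - snd z) / h\<rfloor>);
          s = (fst y - fst z) / h - real p;
          t = (snd y - snd z) / h - real q
      in (1 - s) * (1 - t) * U p q + s * (1 - t) * U (p + 1) q
         + (1 - s) * t * U p (q + 1) + s * t * U (p + 1) (q + 1))"

text \<open>Step length and value at the end of the step from \<open>x\<close> in direction \<open>e\<close>; the backward
  step uses direction \<open>- e\<close>. For convex open \<open>\<Omega>\<close> and \<open>x \<in> \<Omega>\<close> the ray from \<open>x\<close> meets the
  boundary at most once, so the description in \<open>step_length\<close> is definite.\<close>

definition step_length ::
  "(real \<times> real) set \<Rightarrow> real \<Rightarrow> real \<times> real \<Rightarrow> real \<times> real \<Rightarrow> real" where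
  "step_length \<Omega> h x e =
     (if x + sqrt h *\<^sub>R e \<in> closure \<Omega> then sqrt h
      else (THE \<eta>. 0 < \<eta> \<and> \<eta> < sqrt h \<and> x + \<eta> *\<^sub>R e \<in> frontier \<Omega>))"

definition step_value ::
  "(real \<times> real) set \<Rightarrow> (real \<times> real \<Rightarrow> real) \<Rightarrow> real \<times> real \<Rightarrow> real \<Rightarrow> nat \<Rightarrow> (nat \<Rightarrow> nat \<Rightarrow> real)
     \<Rightarrow> real \<times> real \<Rightarrow> real \<times> real \<Rightarrow> real" where
  "step_value \<Omega> g z h N U x e =
     (if x + sqrt h *\<^sub>R e \<in> closure \<Omega> then bilinear_interp z h N U (x + sqrt h *\<^sub>R e)
      else g (x + step_length \<Omega> h x e *\<^sub>R e))"

definition delta_dir ::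
  "(real \<times> real) set \<Rightarrow> (real \<times> real \<Rightarrow> real) \<Rightarrow> real \<times> real \<Rightarrow> real \<Rightarrow> nat \<Rightarrow> (nat \<Rightarrow> nat \<Rightarrow> real)
     \<Rightarrow> nat \<Rightarrow> nat \<Rightarrow> real \<times> real \<Rightarrow> real" where
  "delta_dir \<Omega> g z h N U i j e =
     (let x = grid_point z h i j;
          \<eta>p = step_length \<Omega> h x e; \<eta>m = step_length \<Omega> h x (- e);
          vp = step_value \<Omega> g z h N U x e; vm = step_value \<Omega> g z h N U x (- e)
      in 2 / (\<eta>p + \<eta>m) * ((vp - U i j) / \<eta>p - (U i j - vm) / \<eta>m))"

definition scheme_L ::
  "(real \<times> real) set \<Rightarrow> (real \<times> real \<Rightarrow> real) \<Rightarrow> (real \<times> real \<Rightarrow> real) \<Rightarrow> real \<times> real \<Rightarrow> real \<Rightarrow> nat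
     \<Rightarrow> nat \<Rightarrow> nat \<Rightarrow> real \<Rightarrow> real \<Rightarrow> (nat \<times> nat \<Rightarrow> real) \<Rightarrow> real" where
  "scheme_L \<Omega> f g z h N i j a \<theta> u =
     (let U = grid_value g z h N u;
          source = 2 * sqrt (a * (1 - a) * f (grid_point z h i j))
      in if alpha11 a \<theta> \<ge> \<bar>alpha12 a \<theta>\<bar> \<and> alpha22 a \<theta> \<ge> \<bar>alpha12 a \<theta>\<bar>
         then - alpha11 a \<theta> * delta_xx h U i j
              - 2 * alpha12 a \<theta> * delta_xy (alpha12 a \<theta>) h U i j
              - alpha22 a \<theta> * delta_yy h U i j + source
         else - a * delta_dir \<Omega> g z h N U i j (cos \<theta>, - sin \<theta>)
              - (1 - a) * delta_dir \<Omega> g z h N U i j (sin \<theta>, cos \<theta>) + source)"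

text \<open>The supremum is taken in the extended reals because \<open>g\<close> is not assumed to be bounded.\<close>

definition scheme_F ::
  "(real \<times> real) set \<Rightarrow> (real \<times> real \<Rightarrow> real) \<Rightarrow> (real \<times> real \<Rightarrow> real) \<Rightarrow> real \<times> real \<Rightarrow> real \<Rightarrow> nat
     \<Rightarrow> nat \<Rightarrow> nat \<Rightarrow> (nat \<times> nat \<Rightarrow> real) \<Rightarrow> ereal" where
  "scheme_F \<Omega> f g z h N i j u =
     (SUP (a, \<theta>) \<in> control_set. ereal (scheme_L \<Omega> f g z h N i j a \<theta> u))"

text \<open>The same operator with the value \<open>c\<close> at \<open>(i, j)\<close> separated from the remaining entries, which
  are taken from \<open>w\<close>; the entry \<open>w (i, j)\<close> is ignored.\<close>

definition scheme_F_split ::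
  "(real \<times> real) set \<Rightarrow> (real \<times> real \<Rightarrow> real) \<Rightarrow> (real \<times> real \<Rightarrow> real) \<Rightarrow> real \<times> real \<Rightarrow> real \<Rightarrow> nat
     \<Rightarrow> nat \<Rightarrow> nat \<Rightarrow> real \<Rightarrow> (nat \<times> nat \<Rightarrow> real) \<Rightarrow> ereal" where
  "scheme_F_split \<Omega> f g z h N i j c w = scheme_F \<Omega> f g z h N i j (w((i, j) := c))"

lemma scheme_F_split_same: "scheme_F_split \<Omega> f g z h N i j (u (i, j)) u = scheme_F \<Omega> f g z h N i j u"
  by (simp add: scheme_F_split_def)

end

theory Submission
  imports Defs
begin

text \<open>Monotonicity is a discrete maximum principle. If the difference \<open>V - U\<close> of two lattice
  functions attains a nonnegative maximum at \<open>(i, j)\<close>, then every difference quotient centred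
  there, being a nonnegative combination of differences between values elsewhere and the central
  value, is at most as large for \<open>V\<close> as for \<open>U\<close>; hence \<open>L(U) \<le> L(V)\<close> for each control, and
  the supremum over the controls preserves this (\<open>scheme_L_comparison\<close>). Both claims are
  instances: raising only the central entry makes the difference maximal there, and lowering only the other
  entries makes its maximum \<open>0\<close>, attained at the centre. In this form it does not matter
  that the bilinear interpolation may involve the central value itself when \<open>h\<close> is not small.

  For the seven-point stencil the case condition \<open>\<bar>\<alpha>\<^sub>1\<^sub>2\<bar> \<le> \<alpha>\<^sub>1\<^sub>1, \<alpha>\<^sub>2\<^sub>2\<close> is exactly
  what makes all weights nonnegative (\<open>seven_point_mono\<close>). The wide stencil needs two
  geometric facts. The steps must have positive length, which is not clear from the
  definite description and uses that a ray from a point of an open convex set crosses the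
  boundary once (\<open>step_length_pos\<close>). And the interpolation weights must lie in \<open>[0, 1]\<close>, so
  the closure of \<open>\<Omega>\<close> must not extend beyond the grid (\<open>closure_in_grid_square\<close>): each side of
  the grid carries three collinear boundary points, and a supporting line at the middle one has to
  contain the whole side.\<close>

section \<open>The closed domain lies in the grid square\<close>

text \<open>A line supporting \<open>S\<close> at \<open>x\<close> has both \<open>x + d\<close> and \<open>x - d\<close> on its nonnegative side, so it
  contains them. In the plane this determines its normal up to a factor,
  and the point \<open>p\<close> determines the sign of that factor.\<close>

lemma supporting_half_plane:
  fixes S :: "(real \<times> real) set"
  assumes "convex S" and x: "x \<notin> S"
    and xd: "x + d \<in> closure S" "x - d \<in> closure S"
    and d: "d \<noteq> 0" "n \<bullet> d = 0"
    and p: "p \<in> closure S" "n \<bullet> x < n \<bullet> p"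
    and y: "y \<in> closure S"
  shows "n \<bullet> x \<le> n \<bullet> y"
proof -
  have "\<exists>a. a \<noteq> 0 \<and> (\<forall>y\<in>closure S. a \<bullet> x \<le> a \<bullet> y)"
  proof -
    have "convex ((\<lambda>y. y - x) ` S)" "0 \<notin> (\<lambda>y. y - x) ` S"
      using \<open>convex S\<close> x by auto
    from separating_hyperplane_set_0[OF this]
    obtain a where "a \<noteq> 0" and "\<forall>y\<in>S. 0 \<le> a \<bullet> (y - x)" by auto
    then have "S \<subseteq> {y. a \<bullet> x \<le> a \<bullet> y}" by (auto simp: inner_diff_right)
    then have "closure S \<subseteq> {y. a \<bullet> x \<le> a \<bullet> y}"
      using closed_halfspace_ge[of "a \<bullet> x" a] by (intro closure_minimal) auto
    with \<open>a \<noteq> 0\<close> show ?thesis by blast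
  qed
  then obtain a where "a \<noteq> 0" and a: "\<And>y. y \<in> closure S \<Longrightarrow> a \<bullet> x \<le> a \<bullet> y"
    by blast
  have ad: "a \<bullet> d = 0"
    using a[OF xd(1)] a[OF xd(2)] by (simp add: inner_add_right inner_diff_right)
  have "fst a * snd n = snd a * fst n"
  proof -
    have "fst a * fst d + snd a * snd d = 0" "fst n * fst d + snd n * snd d = 0"
      using ad d(2) by (auto simp: inner_prod_def)
    then have "(fst a * snd n - snd a * fst n) * fst d = 0"
      "(fst a * snd n - snd a * fst n) * snd d = 0" by algebra+
    then show ?thesis using d(1) by (auto simp: prod_eq_iff)
  qed
  \<comment> \<open>\<open>a\<close> and \<open>n\<close> are parallel, and \<open>a \<bullet> n\<close> has the sign of the factor between them\<close>
  then have par: "(a \<bullet> n) * (n \<bullet> w) = (n \<bullet> n) * (a \<bullet> w)" for w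
    unfolding inner_prod_def inner_real_def by algebra
  have "n \<noteq> 0" using p(2) by auto
  have "a \<bullet> n \<noteq> 0"
  proof
    assume "a \<bullet> n = 0"
    then have "a \<bullet> a = 0" using par[of a] \<open>n \<noteq> 0\<close> by auto
    then show False using \<open>a \<noteq> 0\<close> by simp
  qed
  have nonneg: "0 \<le> (a \<bullet> n) * (n \<bullet> (w - x))" if "w \<in> closure S" for w
    using par[of "w - x"] a[OF that] by (simp add: inner_diff_right)
  have "0 < a \<bullet> n"
    using nonneg[OF p(1)] p(2) \<open>a \<bullet> n \<noteq> 0\<close> by (auto simp: inner_diff_right zero_le_mult_iff)
  then show ?thesis
    using nonneg[OF y] by (auto simp: inner_diff_right zero_le_mult_iff)
qed

lemma closure_in_grid_square:
  assumes "convex \<Omega>" and "open \<Omega>" and h: "h > 0" and N: "N \<ge> 1"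
    and int: "\<forall>p\<in>{1..N}. \<forall>q\<in>{1..N}. grid_point z h p q \<in> \<Omega>"
    and bd: "\<forall>p\<in>{0..N + 1}. \<forall>q\<in>{0..N + 1}.
           p \<in> {0, N + 1} \<or> q \<in> {0, N + 1} \<longrightarrow> grid_point z h p q \<in> frontier \<Omega>"
    and y: "y \<in> closure \<Omega>"
  shows "fst z \<le> fst y \<and> fst y \<le> fst z + real (N + 1) * h \<and>
         snd z \<le> snd y \<and> snd y \<le> snd z + real (N + 1) * h"
proof -
  have fr: "grid_point z h p q \<in> frontier \<Omega>" if "p \<le> N + 1" "q \<le> N + 1"
    "p = 0 \<or> p = N + 1 \<or> q = 0 \<or> q = N + 1" for p q
    using bd[rule_format, of p q] that by auto
  have c: "grid_point z h 1 1 \<in> closure \<Omega>"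
    using int N closure_subset by fastforce
  \<comment> \<open>the interior grid point \<open>(1, 1)\<close> tells on which side of each edge the domain lies\<close>
  have side: "n \<bullet> x \<le> n \<bullet> y"
    if "d \<noteq> 0" "n \<bullet> d = 0" "x \<in> frontier \<Omega>" "x + d \<in> frontier \<Omega>" "x - d \<in> frontier \<Omega>"
      "n \<bullet> x < n \<bullet> grid_point z h 1 1" for n d x
    using that \<open>open \<Omega>\<close>
    by (intro supporting_half_plane[OF \<open>convex \<Omega>\<close> _ _ _ that(1,2) c _ y])
      (auto simp: frontier_def interior_open)
  have shift:
    "grid_point z h 1 q + (h, 0) = grid_point z h 2 q"
    "grid_point z h 1 q - (h, 0) = grid_point z h 0 q"
    "grid_point z h p 1 + (0, h) = grid_point z h p 2"
    "grid_point z h p 1 - (0, h) = grid_point z h p 0" for p q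
    by (simp_all add: grid_point_def)
  have lt: "h < real (N + 1) * h"
    using h N by simp
  have "(0, 1) \<bullet> grid_point z h 1 0 \<le> (0, 1) \<bullet> y"
    by (intro side[of "(h, 0)"]; (subst shift)?; (rule fr)?)
      (use h N lt in \<open>auto simp: grid_point_def zero_prod_def\<close>)
  moreover have "(0, - 1) \<bullet> grid_point z h 1 (N + 1) \<le> (0, - 1) \<bullet> y"
    by (intro side[of "(h, 0)"]; (subst shift)?; (rule fr)?)
      (use h N lt in \<open>auto simp: grid_point_def zero_prod_def\<close>)
  moreover have "(1, 0) \<bullet> grid_point z h 0 1 \<le> (1, 0) \<bullet> y"
    by (intro side[of "(0, h)"]; (subst shift)?; (rule fr)?)
      (use h N lt in \<open>auto simp: grid_point_def zero_prod_def\<close>)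
  moreover have "(- 1, 0) \<bullet> grid_point z h (N + 1) 1 \<le> (- 1, 0) \<bullet> y"
    by (intro side[of "(0, h)"]; (subst shift)?; (rule fr)?)
      (use h N lt in \<open>auto simp: grid_point_def zero_prod_def\<close>)
  ultimately show ?thesis
    by (simp add: grid_point_def inner_prod_def)
qed

section \<open>Step lengths and interpolation\<close>

text \<open>This is what makes the exit point of a ray from an interior point unique: everything before
  a boundary point on the ray is interior.\<close>

lemma ray_before_closure_in_interior:
  fixes S :: "'a::euclidean_space set"
  assumes "convex S" "x \<in> interior S" "x + c *\<^sub>R e \<in> closure S" "0 < b" "b < c"
  shows "x + b *\<^sub>R e \<in> interior S"
proof -
  have "(x + c *\<^sub>R e) - (1 - b / c) *\<^sub>R ((x + c *\<^sub>R e) - x) \<in> interior S"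
    using assms by (intro mem_interior_closure_convex_shrink) auto
  also have "(x + c *\<^sub>R e) - (1 - b / c) *\<^sub>R ((x + c *\<^sub>R e) - x) = x + b *\<^sub>R e"
    using assms(4,5) by (simp add: algebra_simps)
  finally show ?thesis .
qed

text \<open>The definite description in \<open>step_length\<close> denotes something: an exit point exists because the
  segment joins \<open>\<Omega>\<close> to its complement, and it is unique by the preceding lemma.\<close>

lemma step_length_pos:
  assumes "convex \<Omega>" "open \<Omega>" "x \<in> \<Omega>" "h > 0"
  shows "0 < step_length \<Omega> h x e"
proof (cases "x + sqrt h *\<^sub>R e \<in> closure \<Omega>")
  case True
  then show ?thesis using assms by (simp add: step_length_def)
next
  case False
  have "closed_segment x (x + sqrt h *\<^sub>R e) \<inter> frontier \<Omega> \<noteq> {}"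
    by (rule connected_Int_frontier) (use assms(3) False closure_subset in auto)
  then obtain t where t: "0 \<le> t" "t \<le> 1" "x + (t * sqrt h) *\<^sub>R e \<in> frontier \<Omega>"
    by (auto simp: in_segment algebra_simps)
  have "t \<noteq> 0"
    using t(3) assms(2,3) by (auto simp: frontier_def interior_open)
  moreover have "t \<noteq> 1" using t(3) False by (auto simp: frontier_def)
  ultimately have "0 < t * sqrt h \<and> t * sqrt h < sqrt h \<and> x + (t * sqrt h) *\<^sub>R e \<in> frontier \<Omega>"
    using t assms(4) by auto
  moreover have "\<not> b < c" if "0 < b" "x + b *\<^sub>R e \<in> frontier \<Omega>" "x + c *\<^sub>R e \<in> frontier \<Omega>" for b c
    using ray_before_closure_in_interior[OF assms(1), of x c e b] that assms(2,3)
    by (auto simp: frontier_def interior_open)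
  ultimately have "\<exists>!\<eta>. 0 < \<eta> \<and> \<eta> < sqrt h \<and> x + \<eta> *\<^sub>R e \<in> frontier \<Omega>"
    by (metis linorder_neqE)
  from theI'[OF this] show ?thesis
    using False by (simp add: step_length_def)
qed

text \<open>The upper bound on \<open>r\<close> matters only when the minimum is \<open>N\<close>, that is, in the last cell, which
  is closed on its right and therefore also contains \<open>r = N + 1\<close>.\<close>

lemma cell_coordinate:
  fixes r :: real
  assumes "0 \<le> r" "r \<le> real (N + 1)"
  shows "0 \<le> r - real (min N (nat \<lfloor>r\<rfloor>))" "r - real (min N (nat \<lfloor>r\<rfloor>)) \<le> 1"
  using assms by (auto simp: min_def; linarith)+

lemma convex_combination_le:
  fixes s t :: real
  assumes "0 \<le> s" "s \<le> 1" "0 \<le> t" "t \<le> 1" "A \<le> M" "B \<le> M" "C \<le> M" "D \<le> M"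
  shows "(1 - s) * (1 - t) * A + s * (1 - t) * B + (1 - s) * t * C + s * t * D \<le> M"
proof -
  have "(1 - s) * (1 - t) * A + s * (1 - t) * B + (1 - s) * t * C + s * t * D
    \<le> (1 - s) * (1 - t) * M + s * (1 - t) * M + (1 - s) * t * M + s * t * M"
    using assms by (intro add_mono mult_left_mono) auto
  also have "\<dots> = M" by (simp add: algebra_simps)
  finally show ?thesis .
qed

text \<open>Interpolation is linear in the nodal values, so the difference of the interpolants
  interpolates \<open>V - U\<close>, and a convex combination of nodal values does not exceed a bound on them.\<close>

lemma bilinear_interp_diff_le:
  assumes "h > 0"
    and y: "fst z \<le> fst y \<and> fst y \<le> fst z + real (N + 1) * h \<and>
         snd z \<le> snd y \<and> snd y \<le> snd z + real (N + 1) * h"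
    and M: "\<And>p q. p \<le> N + 1 \<Longrightarrow> q \<le> N + 1 \<Longrightarrow> V p q - U p q \<le> M"
  shows "bilinear_interp z h N V y - bilinear_interp z h N U y \<le> M"
proof -
  define p where "p = min N (nat \<lfloor>(fst y - fst z) / h\<rfloor>)"
  define q where "q = min N (nat \<lfloor>(snd y - snd z) / h\<rfloor>)"
  define s where "s = (fst y - fst z) / h - real p"
  define t where "t = (snd y - snd z) / h - real q"
  have "0 \<le> s" "s \<le> 1" "0 \<le> t" "t \<le> 1"
    unfolding s_def t_def p_def q_def using assms
    by (intro cell_coordinate; simp add: field_simps)+
  moreover have "p \<le> N" "q \<le> N" by (auto simp: p_def q_def)
  ultimately have "(1 - s) * (1 - t) * (V p q - U p q) + s * (1 - t) * (V (p+1) q - U (p+1) q)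
      + (1 - s) * t * (V p (q+1) - U p (q+1)) + s * t * (V (p+1) (q+1) - U (p+1) (q+1)) \<le> M"
    by (intro convex_combination_le M) auto
  then show ?thesis
    unfolding bilinear_interp_def Let_def p_def[symmetric] q_def[symmetric]
      s_def[symmetric] t_def[symmetric] by (simp add: algebra_simps)
qed

section \<open>Comparison at a maximum of the difference\<close>

text \<open>Splitting \<open>\<bar>c\<bar>\<close> off both diagonal coefficients turns the operator into second differences
  along the two axes and one diagonal (the main one for \<open>c \<ge> 0\<close>, the other one for \<open>c < 0\<close>), with the
  coefficients \<open>a11 - \<bar>c\<bar>\<close>, \<open>a22 - \<bar>c\<bar>\<close> and \<open>\<bar>c\<bar>\<close>.\<close>

lemma seven_point_mono:
  assumes "\<bar>c\<bar> \<le> a11" "\<bar>c\<bar> \<le> a22"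
    and M: "\<And>p q. p \<in> {i-1..i+1} \<Longrightarrow> q \<in> {j-1..j+1} \<Longrightarrow> V p q - U p q \<le> V i j - U i j"
  shows "- a11 * delta_xx h U i j - 2 * c * delta_xy c h U i j - a22 * delta_yy h U i j
     \<le> - a11 * delta_xx h V i j - 2 * c * delta_xy c h V i j - a22 * delta_yy h V i j"
proof -
  define W where "W p q = (V i j - U i j) - (V p q - U p q)" for p q
  have W: "0 \<le> W p q" if "p \<in> {i-1..i+1}" "q \<in> {j-1..j+1}" for p q
    using M[OF that] by (simp add: W_def)
  \<comment> \<open>\<open>W\<close> is the gap below the maximum of \<open>V - U\<close>; it vanishes at \<open>(i, j)\<close>, so second differences
    of \<open>- W\<close> there are just sums of two neighbouring gaps, with a minus sign\<close>
  define D where "D = (if 0 \<le> c then W (i+1) (j+1) + W (i-1) (j-1) else W (i+1) (j-1) + W (i-1) (j+1))"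
  have "0 \<le> ((a11 - \<bar>c\<bar>) * (W (i+1) j + W (i-1) j) + (a22 - \<bar>c\<bar>) * (W i (j+1) + W i (j-1))
     + \<bar>c\<bar> * D) / h\<^sup>2"
    unfolding D_def using assms(1,2)
    by (intro divide_nonneg_nonneg add_nonneg_nonneg mult_nonneg_nonneg) (auto intro!: add_nonneg_nonneg W)
  also have "\<dots> = (- a11 * delta_xx h V i j - 2 * c * delta_xy c h V i j - a22 * delta_yy h V i j)
     - (- a11 * delta_xx h U i j - 2 * c * delta_xy c h U i j - a22 * delta_yy h U i j)"
  proof -
    define k where "k = 1 / h\<^sup>2"
    have xx: "delta_xx h X i j = k * (X (i + 1) j - 2 * X i j + X (i - 1) j)"
      and yy: "delta_yy h X i j = k * (X i (j + 1) - 2 * X i j + X i (j - 1))"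
      and xy: "2 * delta_xy c h X i j = (if 0 \<le> c
        then k * (2 * X i j + X (i + 1) (j + 1) + X (i - 1) (j - 1)
                  - X (i + 1) j - X (i - 1) j - X i (j + 1) - X i (j - 1))
        else k * (- 2 * X i j - X (i + 1) (j - 1) - X (i - 1) (j + 1)
                  + X (i + 1) j + X (i - 1) j + X i (j + 1) + X i (j - 1)))" for X
      by (simp_all add: delta_xx_def delta_yy_def delta_xy_def k_def flip: divide_divide_eq_left)
    \<comment> \<open>brings the factor 2 to the mixed quotient, where it cancels the one half\<close>
    have comm: "2 * c * delta_xy c h X i j = c * (2 * delta_xy c h X i j)" for X
      by simp
    have k: "Y / h\<^sup>2 = k * Y" for Y by (simp add: k_def)
    show ?thesis
      unfolding comm xx yy xy k D_def W_def
      by (cases "0 \<le> c") (simp_all add: algebra_simps)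
  qed
  finally show ?thesis by simp
qed

lemma delta_dir_antimono:
  assumes pos: "\<And>e. 0 < step_length \<Omega> h (grid_point z h i j) e"
    and le: "\<And>e. step_value \<Omega> g z h N V (grid_point z h i j) e
                - step_value \<Omega> g z h N U (grid_point z h i j) e \<le> V i j - U i j"
  shows "delta_dir \<Omega> g z h N V i j e \<le> delta_dir \<Omega> g z h N U i j e"
proof -
  let ?x = "grid_point z h i j"
  have "(step_value \<Omega> g z h N V ?x e - V i j) / step_length \<Omega> h ?x e
      \<le> (step_value \<Omega> g z h N U ?x e - U i j) / step_length \<Omega> h ?x e"
    using le[of e] pos[of e] by (intro divide_right_mono) auto
  moreover have "(U i j - step_value \<Omega> g z h N U ?x (- e)) / step_length \<Omega> h ?x (- e)
      \<le> (V i j - step_value \<Omega> g z h N V ?x (- e)) / step_length \<Omega> h ?x (- e)"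
    using le[of "- e"] pos[of "- e"] by (intro divide_right_mono) auto
  ultimately show ?thesis
    unfolding delta_dir_def Let_def
    using pos[of e] pos[of "- e"] by (intro mult_left_mono diff_mono) auto
qed

text \<open>The maximum is assumed only over the interior indices. Boundary values of the two grid functions
  coincide, so there the difference is \<open>0\<close>; this is where nonnegativity of the maximum enters, for the
  boundary nodes as well as for steps that end on the boundary of \<open>\<Omega>\<close>.\<close>

lemma scheme_L_comparison:
  assumes "convex \<Omega>" "open \<Omega>" and h: "h > 0"
    and int: "\<forall>p\<in>{1..N}. \<forall>q\<in>{1..N}. grid_point z h p q \<in> \<Omega>"
    and bd: "\<forall>p\<in>{0..N + 1}. \<forall>q\<in>{0..N + 1}.
           p \<in> {0, N + 1} \<or> q \<in> {0, N + 1} \<longrightarrow> grid_point z h p q \<in> frontier \<Omega>"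
    and ij: "i \<in> {1..N}" "j \<in> {1..N}"
    and a: "0 \<le> a" "a \<le> 1"
    and nonneg: "u (i, j) \<le> v (i, j)"
    and max: "\<And>p q. p \<in> {1..N} \<Longrightarrow> q \<in> {1..N} \<Longrightarrow> v (p, q) - u (p, q) \<le> v (i, j) - u (i, j)"
  shows "scheme_L \<Omega> f g z h N i j a \<theta> u \<le> scheme_L \<Omega> f g z h N i j a \<theta> v"
proof -
  define U where "U = grid_value g z h N u"
  define V where "V = grid_value g z h N v"
  define x where "x = grid_point z h i j"
  have W: "V p q - U p q \<le> V i j - U i j" for p q
    using max nonneg ij by (auto simp: U_def V_def grid_value_def)
  have W0: "0 \<le> V i j - U i j"
    using nonneg ij by (simp add: U_def V_def grid_value_def)
  have x: "x \<in> \<Omega>" using int ij by (simp add: x_def)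
  have pos: "0 < step_length \<Omega> h x e" for e
    using step_length_pos assms(1,2) x h by blast
  have val: "step_value \<Omega> g z h N V x e - step_value \<Omega> g z h N U x e \<le> V i j - U i j" for e
  proof (cases "x + sqrt h *\<^sub>R e \<in> closure \<Omega>")
    case True
    have "1 \<le> N" using ij by simp
    then show ?thesis
      using bilinear_interp_diff_le[OF h closure_in_grid_square[OF assms(1,2) h _ int bd True] W] True
      by (simp add: step_value_def)
  next
    case False
    then show ?thesis using W0 by (simp add: step_value_def)
  qed
  have dir: "delta_dir \<Omega> g z h N V i j e \<le> delta_dir \<Omega> g z h N U i j e" for e
    using delta_dir_antimono pos val unfolding x_def by blast
  have wide: "- a * delta_dir \<Omega> g z h N U i j e - (1 - a) * delta_dir \<Omega> g z h N U i j e'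
     \<le> - a * delta_dir \<Omega> g z h N V i j e - (1 - a) * delta_dir \<Omega> g z h N V i j e'" for e e'
    using mult_left_mono[OF dir[of e] a(1)] mult_left_mono[OF dir[of e'], of "1 - a"] a by linarith
  show ?thesis
    unfolding scheme_L_def Let_def U_def[symmetric] V_def[symmetric]
    using seven_point_mono[of "alpha12 a \<theta>" "alpha11 a \<theta>" "alpha22 a \<theta>" i j V U h, OF _ _ W] wide
    by auto
qed

theorem lemma8:
  fixes \<Omega> :: "(real \<times> real) set"
    and f g :: "real \<times> real \<Rightarrow> real"
    and z :: "real \<times> real"
    and h :: real
    and N :: nat
    and u v :: "nat \<times> nat \<Rightarrow> real"
    and i j :: nat
  assumes "bounded \<Omega>" and "convex \<Omega>" and "open \<Omega>"
    and "\<forall>x\<in>\<Omega>. f x \<ge> 0"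
    and "h > 0"
    and "\<forall>p\<in>{1..N}. \<forall>q\<in>{1..N}. grid_point z h p q \<in> \<Omega>"
    and "\<forall>p\<in>{0..N + 1}. \<forall>q\<in>{0..N + 1}.
           p \<in> {0, N + 1} \<or> q \<in> {0, N + 1} \<longrightarrow> grid_point z h p q \<in> frontier \<Omega>"
    and "\<forall>p\<in>{1..N}. \<forall>q\<in>{1..N}. u (p, q) \<le> v (p, q)"
    and "i \<in> {1..N}" and "j \<in> {1..N}"
  shows "scheme_F_split \<Omega> f g z h N i j (u (i, j)) u \<le> scheme_F_split \<Omega> f g z h N i j (v (i, j)) u
       \<and> scheme_F_split \<Omega> f g z h N i j (u (i, j)) u \<ge> scheme_F_split \<Omega> f g z h N i j (u (i, j)) v"
proof -
  have F: "scheme_F \<Omega> f g z h N i j u' \<le> scheme_F \<Omega> f g z h N i j v'"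
    if "u' (i, j) \<le> v' (i, j)"
      "\<And>p q. p \<in> {1..N} \<Longrightarrow> q \<in> {1..N} \<Longrightarrow> v' (p, q) - u' (p, q) \<le> v' (i, j) - u' (i, j)" for u' v'
    unfolding scheme_F_def
  proof (rule SUP_mono)
    fix c assume "c \<in> control_set"
    moreover have "scheme_L \<Omega> f g z h N i j (fst c) (snd c) u' \<le> scheme_L \<Omega> f g z h N i j (fst c) (snd c) v'"
      using \<open>c \<in> control_set\<close>
      by (intro scheme_L_comparison[OF assms(2,3,5,6,7,9,10)] that) (auto simp: control_set_def)
    ultimately show "\<exists>c'\<in>control_set. (case c of (a, \<theta>) \<Rightarrow> ereal (scheme_L \<Omega> f g z h N i j a \<theta> u'))
      \<le> (case c' of (a, \<theta>) \<Rightarrow> ereal (scheme_L \<Omega> f g z h N i j a \<theta> v'))"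
      by (auto simp: case_prod_beta)
  qed
  \<comment> \<open>first part: the difference is \<open>v (i, j) - u (i, j)\<close> at the centre and \<open>0\<close> elsewhere; second
    part: it is \<open>0\<close> at the centre and \<open>u - v\<close> elsewhere\<close>
  show ?thesis
    unfolding scheme_F_split_def using assms(8-10) by (auto intro!: F)
qed

end
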